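(* $g(S(a,b))=\Theta(a^{3/2}+ab)$; that is, there exist real constants $c_1,c_2>0$ such that for all integers $a\geq 2$, $b\geq 1$ with $\gcd(a,b)=1$, $$c_1\,(a^{3/2}+ab)\leq g(S(a,b))\leq c_2\,(a^{3/2}+ab).$$
   Context: $\mathbb{N}_0=\{0,1,2,\ldots\}$ and $\binom{n}{2}=\frac{n(n-1)}{2}$. For $a,b\in\mathbb{N}_0$, $S(a,b)$ is the submonoid of $(\mathbb{N}_0,+)$ generated by $\left\{na+\binom{n}{2}b : n\in\mathbb{N}_0\right\}$; it is a numerical semigroup (a submonoid of $\mathbb{N}_0$ with finite complement) exactly when $\gcd(a,b)=1$. For a numerical semigroup $S$, the genus $g(S)$ is the cardinality of $\mathbb{N}_0\setminus S$. *)

theory Defs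
  imports Complex_Main
begin

inductive_set submonoid_generated :: "'a::comm_monoid_add set \<Rightarrow> 'a set"
  for G :: "'a set"
where
  zero: "0 \<in> submonoid_generated G"
| gen: "x \<in> G \<Longrightarrow> x \<in> submonoid_generated G"
| add: "x \<in> submonoid_generated G \<Longrightarrow> y \<in> submonoid_generated G \<Longrightarrow> x + y \<in> submonoid_generated G"

definition S :: "nat \<Rightarrow> nat \<Rightarrow> nat set"
  where "S a b = submonoid_generated {n * a + (n choose 2) * b | n. True}"

(* Meaningful only when the complement is finite, since card of an infinite set is 0. *)
definition genus :: "nat set \<Rightarrow> nat"
  where "genus M = card (- M)"

end

(* Every element of S a b is N * a + M * b with 2 * M \<le> N\<^sup>2, and conversely every M admits such
   an element with N \<le> 6 * sqrt M: take one generator with n choose 2 \<le> M < Suc n choose 2 and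
   fill up with copies of 2 * a + b. As a and b are coprime, the residue classes modulo a are those
   of M * b with M < a, so the class of M * b contains between M * b / a - 1 + sqrt (2 * M) and
   M * b / a + 6 * sqrt M gaps. Summing over M < a gives both bounds. *)
theory Submission
  imports Defs "HOL-Number_Theory.Cong"
begin

section \<open>Elements of the monoid \<open>S a b\<close>\<close>

lemma submonoid_generated_mult:
  fixes x :: nat
  assumes "x \<in> submonoid_generated G"
  shows "k * x \<in> submonoid_generated G"
  by (induction k) (auto intro: assms submonoid_generated.intros)

lemma two_choose_two: "2 * (n choose 2) = n * (n - 1)"
  by (cases n) (simp_all add: choose_two)

lemma choose_two_generator_in_S: "n * a + (n choose 2) * b \<in> S a b"
  unfolding S_def by (rule submonoid_generated.gen) blast

lemma S_add: "x \<in> S a b \<Longrightarrow> y \<in> S a b \<Longrightarrow> x + y \<in> S a b"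
  unfolding S_def by (rule submonoid_generated.add)

lemma S_mult: "x \<in> S a b \<Longrightarrow> k * x \<in> S a b"
  unfolding S_def by (rule submonoid_generated_mult)

text \<open>The generator with \<open>n = 1\<close> is \<open>a\<close> itself, so within each
  residue class modulo \<open>a\<close> membership is inherited upwards.\<close>

lemma S_add_mult:
  assumes "x \<in> S a b"
  shows "x + k * a \<in> S a b"
proof -
  have "a \<in> S a b"
    using choose_two_generator_in_S[of 1 a b] by (simp add: binomial_eq_0)
  with assms show ?thesis
    by (intro S_add S_mult)
qed

text \<open>One generator satisfies the inequality since
  \<open>2 * (n choose 2) = n * (n - 1)\<close>, and sums preserve it since the sum of two squares
  is at most the square of the sum.\<close>

lemma S_elem_form:
  assumes "x \<in> S a b"
  obtains N M where "x = N * a + M * b" "2 * M \<le> N\<^sup>2"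
proof -
  have "\<exists>N M. x = N * a + M * b \<and> 2 * M \<le> N\<^sup>2"
    using assms unfolding S_def
  proof (induction rule: submonoid_generated.induct)
    case zero
    show ?case
      by (intro exI[of _ 0]) simp
  next
    case (gen x)
    then obtain n where "x = n * a + (n choose 2) * b"
      by blast
    moreover have "2 * (n choose 2) \<le> n\<^sup>2"
      by (simp add: two_choose_two power2_eq_square)
    ultimately show ?case
      by blast
  next
    case (add x y)
    then obtain N M N' M' where "x = N * a + M * b" "2 * M \<le> N\<^sup>2"
      "y = N' * a + M' * b" "2 * M' \<le> N'\<^sup>2"
      by blast
    then have "x + y = (N + N') * a + (M + M') * b" "2 * (M + M') \<le> (N + N')\<^sup>2"
      by (auto simp: algebra_simps power2_sum add_mono trans_le_add1)
    then show ?case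
      by blast
  qed
  with that show ?thesis
    by blast
qed

text \<open>Consecutive values \<open>n choose 2\<close> and \<open>Suc n choose 2\<close> differ by
  \<open>n\<close>, so the intervals between them cover all naturals.\<close>

lemma choose_two_decomposition:
  obtains n m where "M = (n choose 2) + m" "m < n"
proof -
  have "\<exists>n m. M = (n choose 2) + m \<and> m < n"
  proof (induction M)
    case 0
    show ?case
      by (intro exI[of _ 1] exI[of _ 0]) (simp add: binomial_eq_0)
  next
    case (Suc M)
    then obtain n m where nm: "M = (n choose 2) + m" "m < n"
      by blast
    show ?case
    proof (cases "Suc m < n")
      case True
      with nm show ?thesis
        by (intro exI[of _ n] exI[of _ "Suc m"]) simp
    next
      case False
      with nm show ?thesis
        \<comment> \<open>Here \<open>Suc m = n\<close>, so \<open>Suc M\<close> is exactly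
          \<open>Suc n choose 2\<close>.\<close>
        by (intro exI[of _ "Suc n"] exI[of _ 0]) (simp add: numeral_2_eq_2)
    qed
  qed
  with that show ?thesis
    by blast
qed

text \<open>The large generator costs \<open>n\<close> copies of \<open>a\<close> and each of the
  \<open>m\<close> fillers \<open>2 * a + b\<close> costs two, so \<open>N = n + 2 * m\<close> is
  below \<open>3 * n\<close>, while \<open>n\<close> is at most \<open>2 * sqrt M\<close>.\<close>

lemma S_small_elem:
  obtains N where "N * a + M * b \<in> S a b" "real N \<le> 6 * sqrt (real M)"
proof (cases "M = 0")
  \<comment> \<open>The decomposition of 0 has \<open>n = 1\<close>, which would give
    \<open>N = 1\<close> and exceed the bound 0.\<close>
  case True
  then show ?thesis
    using that[of 0] choose_two_generator_in_S[of 0 a b] by (simp add: binomial_eq_0)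
next
  case False
  obtain n m where nm: "M = (n choose 2) + m" "m < n"
    by (rule choose_two_decomposition)
  have "2 \<le> n"
    using False nm by (cases "n = 1") (auto simp: binomial_eq_0)
  have "(n * a + (n choose 2) * b) + m * (2 * a + (2 choose 2) * b) \<in> S a b"
    by (intro S_add S_mult choose_two_generator_in_S)
  then have "(n + 2 * m) * a + M * b \<in> S a b"
    by (simp add: nm algebra_simps)
  moreover have "real (n + 2 * m) \<le> 6 * sqrt (real M)"
  proof -
    have "n * n \<le> n * (2 * (n - 1))"
      using \<open>2 \<le> n\<close> by (intro mult_left_mono) auto
    also have "\<dots> = 4 * (n choose 2)"
      using two_choose_two[of n] by simp
    also have "\<dots> \<le> 4 * M"
      by (simp add: nm)
    finally have "real (n * n) \<le> real (4 * M)"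
      by (simp only: of_nat_le_iff)
    then have "real n \<le> sqrt (4 * real M)"
      by (intro real_le_rsqrt) (simp add: power2_eq_square)
    then have "real n \<le> 2 * sqrt (real M)"
      by (simp add: real_sqrt_mult)
    then show ?thesis
      using nm(2) by simp
  qed
  ultimately show ?thesis
    by (rule that)
qed

section \<open>Gaps in one residue class modulo \<open>a\<close>\<close>

text \<open>A gap is recorded by its quotient by \<open>a\<close>. The class is labelled by the
  multiplier \<open>M\<close> rather than by its residue, because both bounds depend on
  \<open>M\<close>.\<close>

definition class_gaps :: "nat \<Rightarrow> nat \<Rightarrow> nat \<Rightarrow> nat set"
  where "class_gaps a b M = {j. j * a + M * b mod a \<notin> S a b}"

text \<open>The small element \<open>N * a + M * b\<close> lies in the class with quotient
  \<open>N + M * b div a\<close>, and from there on the class contains no gap.\<close>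

lemma class_gaps_upper:
  assumes "a > 0"
  shows "finite (class_gaps a b M)"
    and "real (card (class_gaps a b M)) \<le> real (M * b div a) + 6 * sqrt (real M)"
proof -
  obtain N where N: "N * a + M * b \<in> S a b" "real N \<le> 6 * sqrt (real M)"
    by (rule S_small_elem)
  have sub: "class_gaps a b M \<subseteq> {..<M * b div a + N}"
  proof
    fix j
    assume j: "j \<in> class_gaps a b M"
    show "j \<in> {..<M * b div a + N}"
    proof (rule ccontr)
      assume "j \<notin> {..<M * b div a + N}"
      then obtain k where k: "j = M * b div a + N + k"
        by (metis lessThan_iff linorder_not_less le_Suc_ex)
      have "j * a + M * b mod a = N * a + (M * b div a * a + M * b mod a) + k * a"
        by (simp add: k algebra_simps)
      also have "\<dots> = N * a + M * b + k * a"
        by simp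
      finally show False
        using j S_add_mult[OF N(1), of k] by (simp add: class_gaps_def)
    qed
  qed
  show "finite (class_gaps a b M)"
    using sub by (rule finite_subset) simp
  have "card (class_gaps a b M) \<le> M * b div a + N"
    using card_mono[OF _ sub] by simp
  then show "real (card (class_gaps a b M)) \<le> real (M * b div a) + 6 * sqrt (real M)"
    using N(2) by linarith
qed

text \<open>An element \<open>N * a + M' * b\<close> of the class has \<open>M'\<close> congruent to
  \<open>M\<close>, hence \<open>M' >= M\<close>. This forces \<open>N\<close> to be at least
  \<open>sqrt (2 * M)\<close> and the quotient to be at least
  \<open>N + M * b div a\<close>.\<close>

lemma class_gaps_lower:
  assumes "coprime a b" "M < a"
  shows "real (M * b div a) + sqrt (2 * real M) \<le> real (card (class_gaps a b M))"
proof -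
  \<comment> \<open>\<open>t\<close> is the least natural number whose square is at least
    \<open>2 * M\<close>.\<close>
  define t where "t = nat \<lceil>sqrt (2 * real M)\<rceil>"
  have "{..<M * b div a + t} \<subseteq> class_gaps a b M"
  proof (rule subsetI, rule ccontr)
    fix j
    assume j: "j \<in> {..<M * b div a + t}" and "j \<notin> class_gaps a b M"
    then have "j * a + M * b mod a \<in> S a b"
      by (simp add: class_gaps_def)
    then obtain N M' where NM: "j * a + M * b mod a = N * a + M' * b" "2 * M' \<le> N\<^sup>2"
      by (rule S_elem_form)
    have "(M' * b) mod a = (N * a + M' * b) mod a"
      by simp
    also have "\<dots> = (M * b) mod a"
      by (simp flip: NM(1))
    finally have "[M' * b = M * b] (mod a)"
      by (simp add: cong_def)
    then have "[M' = M] (mod a)"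
      using \<open>coprime a b\<close> cong_mult_rcancel_nat[of b a M' M] by (simp add: coprime_commute)
    then have "M' mod a = M"
      using \<open>M < a\<close> by (simp add: cong_def)
    then have "M \<le> M'"
      by auto
    have "(N + M * b div a) * a + M * b mod a = N * a + (M * b div a * a + M * b mod a)"
      by (simp add: algebra_simps)
    also have "\<dots> = N * a + M * b"
      by simp
    also have "\<dots> \<le> j * a + M * b mod a"
      using \<open>M \<le> M'\<close> by (simp add: NM(1))
    \<comment> \<open>Both sides carry the same remainder modulo \<open>a\<close>, so the quotients
      can be compared.\<close>
    finally have "N + M * b div a \<le> j"
      using \<open>M < a\<close> by simp
    with j have "N < t"
      by simp
    moreover have "t \<le> N"
    proof -
      have "real (2 * M) \<le> real (N\<^sup>2)"
        using NM(2) \<open>M \<le> M'\<close> by (simp only: of_nat_le_iff)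
      then have "sqrt (2 * real M) \<le> real N"
        by (intro real_le_lsqrt) auto
      then show ?thesis
        by (simp add: t_def ceiling_le_iff)
    qed
    ultimately show False
      by simp
  qed
  then have "card {..<M * b div a + t} \<le> card (class_gaps a b M)"
    using \<open>M < a\<close> by (intro card_mono class_gaps_upper) auto
  then have "real (M * b div a) + real t \<le> real (card (class_gaps a b M))"
    by simp
  moreover have "sqrt (2 * real M) \<le> real t"
    unfolding t_def by (rule real_nat_ceiling_ge)
  ultimately show ?thesis
    by linarith
qed

section \<open>Summation over the residue classes\<close>

text \<open>By coprimality, multiplication by \<open>b\<close> permutes the residues modulo
  \<open>a\<close>, so each gap corresponds to exactly one label \<open>M < a\<close> and one
  quotient.\<close>

lemma genus_eq_sum_class_gaps:
  assumes "coprime a b" "a > 0"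
  shows "genus (S a b) = (\<Sum>M<a. card (class_gaps a b M))"
proof -
  have inj: "inj_on (\<lambda>M. M * b mod a) {..<a}"
  proof (rule inj_onI)
    fix M M'
    assume M: "M \<in> {..<a}" "M' \<in> {..<a}" "M * b mod a = M' * b mod a"
    then have "[M = M'] (mod a)"
      using \<open>coprime a b\<close> cong_mult_rcancel_nat[of b a M M']
      by (simp add: coprime_commute cong_def)
    with M show "M = M'"
      by (simp add: cong_def)
  qed
  then have img: "(\<lambda>M. M * b mod a) ` {..<a} = {..<a}"
    using \<open>a > 0\<close> by (intro endo_inj_surj) auto
  define f where "f = (\<lambda>(M, j). j * a + M * b mod a)"
  have "bij_betw f (SIGMA M:{..<a}. class_gaps a b M) (- S a b)"
    unfolding bij_betw_def
  proof
    show "inj_on f (SIGMA M:{..<a}. class_gaps a b M)"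
    proof (rule inj_onI)
      fix p p'
      assume "p \<in> (SIGMA M:{..<a}. class_gaps a b M)" "p' \<in> (SIGMA M:{..<a}. class_gaps a b M)"
        and "f p = f p'"
      then obtain M j M' j' where p: "p = (M, j)" "p' = (M', j')"
        and M: "M \<in> {..<a}" "M' \<in> {..<a}" and eq: "f (M, j) = f (M', j')"
        by blast
      have "M * b mod a = f (M, j) mod a"
        by (simp add: f_def)
      also have "\<dots> = M' * b mod a"
        by (simp add: eq) (simp add: f_def)
      finally have "M = M'"
        using inj M by (auto dest: inj_onD)
      with eq \<open>a > 0\<close> show "p = p'"
        by (simp add: f_def p)
    qed
    show "f ` (SIGMA M:{..<a}. class_gaps a b M) = - S a b"
    proof (intro equalityI subsetI)
      fix x
      assume x: "x \<in> - S a b"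
      have "x mod a \<in> (\<lambda>M. M * b mod a) ` {..<a}"
        using img \<open>a > 0\<close> by simp
      then obtain M where M: "M < a" "x mod a = M * b mod a"
        by auto
      have "x = f (M, x div a)"
        by (simp add: f_def flip: M(2))
      moreover have "x div a \<in> class_gaps a b M"
        using x by (simp add: class_gaps_def flip: M(2))
      ultimately show "x \<in> f ` (SIGMA M:{..<a}. class_gaps a b M)"
        using M(1) by blast
    qed (auto simp: f_def class_gaps_def)
  qed
  then have "genus (S a b) = card (SIGMA M:{..<a}. class_gaps a b M)"
    unfolding genus_def by (simp add: bij_betw_same_card)
  also have "\<dots> = (\<Sum>M<a. card (class_gaps a b M))"
    using class_gaps_upper(1)[OF \<open>a > 0\<close>] by (intro card_SigmaI) auto
  finally show ?thesis .
qed

lemma powr_three_halves: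
  assumes "x \<ge> 0"
  shows "x powr (3 / 2) = x * sqrt x"
proof -
  have "x powr (3 / 2) = x powr (1 + 1 / 2)"
    by simp
  also have "\<dots> = x * sqrt x"
    using assms by (simp only: powr_add powr_half_sqrt) simp
  finally show ?thesis .
qed

text \<open>For \<open>M < a\<close> the class bound is at most \<open>b + 6 * sqrt a\<close>, and
  there are \<open>a\<close> classes.\<close>

lemma genus_upper:
  assumes "coprime a b" "a > 0"
  shows "real (genus (S a b)) \<le> 6 * (real a powr (3/2) + real a * real b)"
proof -
  have "real (genus (S a b)) = (\<Sum>M<a. real (card (class_gaps a b M)))"
    using assms by (simp add: genus_eq_sum_class_gaps)
  also have "\<dots> \<le> (\<Sum>M<a. real b + 6 * sqrt (real a))"
  proof (rule sum_mono)
    fix M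
    assume "M \<in> {..<a}"
    then have "M * b div a \<le> a * b div a"
      by (intro div_le_mono mult_right_mono) auto
    then have "real (M * b div a) \<le> real b"
      using \<open>a > 0\<close> by simp
    moreover have "sqrt (real M) \<le> sqrt (real a)"
      using \<open>M \<in> {..<a}\<close> by simp
    ultimately show "real (card (class_gaps a b M)) \<le> real b + 6 * sqrt (real a)"
      using class_gaps_upper(2)[OF \<open>a > 0\<close>, of b M] by linarith
  qed
  also have "\<dots> \<le> 6 * (real a powr (3/2) + real a * real b)"
    by (simp add: powr_three_halves algebra_simps)
  finally show ?thesis .
qed

text \<open>Each class bound is weakened to a multiple \<open>q * M\<close>, using that
  \<open>sqrt M\<close> is at least \<open>M / sqrt a\<close>. Then only the sum of the first
  integers is needed, not a sum of square roots.\<close>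

lemma genus_lower:
  assumes "coprime a b" "a \<ge> 2"
  shows "(real a powr (3/2) + real a * real b) / 16 \<le> real (genus (S a b))"
proof -
  define s where "s = sqrt (real a)"
  have s: "s > 0" "real a = s * s"
    using \<open>a \<ge> 2\<close> by (auto simp: s_def)
  define q where "q = 1 / (4 * s) + real b / real a"
  have "q \<ge> 0"
    using s by (simp add: q_def)
  have gauss: "(\<Sum>M<n. real M) = real n * (real n - 1) / 2" for n
    by (induction n) (auto simp: field_simps)
  \<comment> \<open>The right side equals \<open>a powr (3/2) / 16 + a * b / 4\<close>, whose first
    term fixes the constant 1/16.\<close>
  have "(real a powr (3/2) + real a * real b) / 16 \<le> q * (real a * real a / 4)"
    using s by (simp add: q_def powr_three_halves flip: s_def) (simp add: s(2) field_simps)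
  also have "\<dots> \<le> q * (\<Sum>M<a. real M)"
  proof (rule mult_left_mono[OF _ \<open>q \<ge> 0\<close>])
    \<comment> \<open>From \<open>a >= 2\<close> follows \<open>a / 2 <= a - 1\<close>.\<close>
    have "real a * (real a / 2) \<le> real a * (real a - 1)"
      using \<open>a \<ge> 2\<close> by (intro mult_left_mono) auto
    then show "real a * real a / 4 \<le> (\<Sum>M<a. real M)"
      by (simp add: gauss)
  qed
  also have "\<dots> = (\<Sum>M<a. q * real M)"
    by (simp add: sum_distrib_left)
  also have "\<dots> \<le> (\<Sum>M<a. real (card (class_gaps a b M)))"
  proof (rule sum_mono)
    fix M
    assume "M \<in> {..<a}"
    show "q * real M \<le> real (card (class_gaps a b M))"
    proof (cases "M = 0")
      case False
      define r where "r = sqrt (real M)"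
      have r: "r \<ge> 1" "real M = r * r"
        using False by (auto simp: r_def)
      have "r \<le> s"
        using \<open>M \<in> {..<a}\<close> by (simp add: r_def s_def)
      have "real (M * b) / real a \<le> real (M * b div a) + 1"
        using floor_divide_of_nat_eq[of "M * b" a, where ?'a = real] by linarith
      \<comment> \<open>This holds as 25/16 is below 2. Of \<open>5 / 4 * r\<close>, one
        \<open>r >= 1\<close> pays for the loss from rounding down \<open>M * b / a\<close>, and the
        remaining \<open>r / 4\<close> covers \<open>M / (4 * s)\<close>.\<close>
      moreover have "5 / 4 * r \<le> sqrt (2 * real M)"
        by (rule real_le_rsqrt) (simp add: r(2) power2_eq_square)
      moreover have "real M / (4 * s) \<le> r / 4"
        using s(1) \<open>r \<le> s\<close> r(1) by (simp add: r(2) field_simps)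
      moreover have "q * real M = real M / (4 * s) + real (M * b) / real a"
        by (simp add: q_def algebra_simps)
      moreover have "real (M * b div a) + sqrt (2 * real M) \<le> real (card (class_gaps a b M))"
        using assms(1) \<open>M \<in> {..<a}\<close> by (intro class_gaps_lower) auto
      ultimately show ?thesis
        using r(1) by linarith
    qed simp
  qed
  also have "\<dots> = real (genus (S a b))"
    using assms by (simp add: genus_eq_sum_class_gaps)
  finally show ?thesis .
qed

theorem corollary8p5:
  shows "\<exists>c\<^sub>1 c\<^sub>2 :: real. c\<^sub>1 > 0 \<and> c\<^sub>2 > 0 \<and>
    (\<forall>a b :: nat. a \<ge> 2 \<longrightarrow> b \<ge> 1 \<longrightarrow> gcd a b = 1 \<longrightarrow>
      c\<^sub>1 * (real a powr (3/2) + real a * real b) \<le> real (genus (S a b)) \<and>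
      real (genus (S a b)) \<le> c\<^sub>2 * (real a powr (3/2) + real a * real b))"
proof (rule exI[of _ "1 / 16"], rule exI[of _ 6], intro conjI allI impI)
  fix a b :: nat
  assume "a \<ge> 2" "gcd a b = 1"
  then have ab: "coprime a b" "a > 0" "a \<ge> 2"
    by (auto simp: coprime_iff_gcd_eq_1)
  show "1 / 16 * (real a powr (3/2) + real a * real b) \<le> real (genus (S a b))"
    using genus_lower[OF ab(1,3)] by simp
  show "real (genus (S a b)) \<le> 6 * (real a powr (3/2) + real a * real b)"
    using genus_upper[OF ab(1,2)] .
qed simp_all

end
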